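(* $\mathrm{FO}(\mathbb{R},\mathbb{Z},+,\leq)=\mathrm{FO}(\mathbb{Z},+,\leq)\uplus\mathrm{FO}(\mathbb{D},+,\leq)$, where $\mathbb{D}=[0,1[$. That is, for every $n\in\mathbb{N}$, a set $R\subseteq\mathbb{R}^n$ is definable in $\mathrm{FO}(\mathbb{R},\mathbb{Z},+,\leq)$ if and only if there exist $p\ge 1$, sets $Z_1,\dots,Z_p\subseteq\mathbb{Z}^n$ definable in $\mathrm{FO}(\mathbb{Z},+,\leq)$ and sets $D_1,\dots,D_p\subseteq\mathbb{D}^n$ definable in $\mathrm{FO}(\mathbb{D},+,\leq)$ such that $R=\bigcup_{i=1}^p(Z_i+D_i)$.
   Context: $\mathbb{D}=[0,1[=\{x\in\mathbb{R}\mid 0\le x<1\}$. For $A,B\subseteq\mathbb{R}^n$, $A+B=\{a+b\mid a\in A,\ b\in B\}$. A first-order logic is identified with the class of sets it defines, and definability is without parameters: - $\mathrm{FO}(\mathbb{R},\mathbb{Z},+,\leq)$: subsets of $\mathbb{R}^n$ ($n\in\mathbb{N}$) first-order definable in the structure with domain $\mathbb{R}$, a unary predicate for membership in $\mathbb{Z}$, addition, and the order $\leq$. - $\mathrm{FO}(\mathbb{Z},+,\leq)$ (Presburger arithmetic): subsets of $\mathbb{Z}^n$ first-order definable in the structure with domain $\mathbb{Z}$, addition and order. - $\mathrm{FO}(\mathbb{D},+,\leq)$: subsets of $\mathbb{D}^n$ first-order definable in the structure with domain $\mathbb{D}$ (quantifiers range over $\mathbb{D}$), the order $\leq$, and the addition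 of reals restricted to $\mathbb{D}$, i.e. the ternary relation $\{(d_1,d_2,d_3)\in\mathbb{D}^3\mid d_1+d_2=d_3\}$. For classes $\mathfrak{Z}$ of subsets of the $\mathbb{Z}^n$ and $\mathfrak{D}$ of subsets of the $\mathbb{D}^n$, $\mathfrak{Z}\uplus\mathfrak{D}$ is the class of all sets $R\subseteq\mathbb{R}^n$ ($n\in\mathbb{N}$) of the form $R=\bigcup_{i=1}^p(Z_i+D_i)$ with $p\ge 1$, $Z_i\in\mathfrak{Z}$, $Z_i\subseteq\mathbb{Z}^n$, $D_i\in\mathfrak{D}$, $D_i\subseteq\mathbb{D}^n$. *)

theory Defs
  imports Complex_Main
begin

text \<open>Points of $M^n$ are lists of length $n$, so that $n$ is an ordinary natural number ($n = 0$
  included) and projection along a quantified variable is the removal of the head.\<close>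

definition tuples :: "real set \<Rightarrow> nat \<Rightarrow> real list set" where
  "tuples M n = {xs. length xs = n \<and> set xs \<subseteq> M}"

definition sumset :: "real list set \<Rightarrow> real list set \<Rightarrow> real list set" where
  "sumset A B = {map2 (+) a b | a b. a \<in> A \<and> b \<in> B}"

definition unit_ico :: "real set" where
  "unit_ico = {0..<1}"


text \<open>First-order formulas over a type of atomic formulas. Variables are de Bruijn indices:
  in an environment \<open>xs\<close>, variable \<open>i\<close> denotes \<open>xs ! i\<close>, and \<open>Exists\<close> binds variable 0.
  \<open>scoped vars n \<phi>\<close> says that the free variables of \<open>\<phi>\<close> are below \<open>n\<close>; only for
  formulas with \<open>scoped vars (length xs) \<phi>\<close> is \<open>sat M holds xs \<phi>\<close> meaningful.\<close>

datatype 'a form = Atom 'a | Neg "'a form" | Conj "'a form" "'a form" | Exists "'a form"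

primrec scoped :: "('a \<Rightarrow> nat set) \<Rightarrow> nat \<Rightarrow> 'a form \<Rightarrow> bool" where
  "scoped vars n (Atom a) \<longleftrightarrow> vars a \<subseteq> {..<n}"
| "scoped vars n (Neg \<phi>) \<longleftrightarrow> scoped vars n \<phi>"
| "scoped vars n (Conj \<phi> \<psi>) \<longleftrightarrow> scoped vars n \<phi> \<and> scoped vars n \<psi>"
| "scoped vars n (Exists \<phi>) \<longleftrightarrow> scoped vars (Suc n) \<phi>"

primrec sat :: "real set \<Rightarrow> (real list \<Rightarrow> 'a \<Rightarrow> bool) \<Rightarrow> real list \<Rightarrow> 'a form \<Rightarrow> bool" where
  "sat M holds xs (Atom a) \<longleftrightarrow> holds xs a"
| "sat M holds xs (Neg \<phi>) \<longleftrightarrow> \<not> sat M holds xs \<phi>"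
| "sat M holds xs (Conj \<phi> \<psi>) \<longleftrightarrow> sat M holds xs \<phi> \<and> sat M holds xs \<psi>"
| "sat M holds xs (Exists \<phi>) \<longleftrightarrow> (\<exists>d\<in>M. sat M holds (d # xs) \<phi>)"

text \<open>A class of sets is represented by the family, indexed by the dimension \<open>n\<close>, of its
  members in dimension \<open>n\<close>.\<close>

definition definable ::
  "real set \<Rightarrow> ('a \<Rightarrow> nat set) \<Rightarrow> (real list \<Rightarrow> 'a \<Rightarrow> bool) \<Rightarrow> nat \<Rightarrow> real list set set" where
  "definable M vars holds n =
     {{xs \<in> tuples M n. sat M holds xs \<phi>} | \<phi>. scoped vars n \<phi>}"


datatype tm = Var nat | Plus tm tm

primrec tm_vars :: "tm \<Rightarrow> nat set" where
  "tm_vars (Var i) = {i}"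
| "tm_vars (Plus s t) = tm_vars s \<union> tm_vars t"

primrec tm_val :: "real list \<Rightarrow> tm \<Rightarrow> real" where
  "tm_val xs (Var i) = xs ! i"
| "tm_val xs (Plus s t) = tm_val xs s + tm_val xs t"


datatype real_int_atom = RZ_Eq tm tm | RZ_Le tm tm | RZ_Int tm

primrec real_int_vars :: "real_int_atom \<Rightarrow> nat set" where
  "real_int_vars (RZ_Eq s t) = tm_vars s \<union> tm_vars t"
| "real_int_vars (RZ_Le s t) = tm_vars s \<union> tm_vars t"
| "real_int_vars (RZ_Int t) = tm_vars t"

primrec real_int_holds :: "real list \<Rightarrow> real_int_atom \<Rightarrow> bool" where
  "real_int_holds xs (RZ_Eq s t) \<longleftrightarrow> tm_val xs s = tm_val xs t"
| "real_int_holds xs (RZ_Le s t) \<longleftrightarrow> tm_val xs s \<le> tm_val xs t"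
| "real_int_holds xs (RZ_Int t) \<longleftrightarrow> tm_val xs t \<in> \<int>"

definition FO_real_int :: "nat \<Rightarrow> real list set set" where
  "FO_real_int = definable UNIV real_int_vars real_int_holds"


datatype int_atom = Z_Eq tm tm | Z_Le tm tm

primrec int_vars :: "int_atom \<Rightarrow> nat set" where
  "int_vars (Z_Eq s t) = tm_vars s \<union> tm_vars t"
| "int_vars (Z_Le s t) = tm_vars s \<union> tm_vars t"

primrec int_holds :: "real list \<Rightarrow> int_atom \<Rightarrow> bool" where
  "int_holds xs (Z_Eq s t) \<longleftrightarrow> tm_val xs s = tm_val xs t"
| "int_holds xs (Z_Le s t) \<longleftrightarrow> tm_val xs s \<le> tm_val xs t"

text \<open>The domain is the set \<open>\<int>\<close> of integral reals rather than the type \<open>int\<close>, so that the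
  definable sets are literally subsets of $\mathbb{R}^n$.\<close>

definition FO_int :: "nat \<Rightarrow> real list set set" where
  "FO_int = definable \<int> int_vars int_holds"


text \<open>The interval \<open>[0,1[\<close> is not closed under addition, so here addition is a ternary relation
  on variables and not a function symbol.\<close>

datatype unit_atom = D_Eq nat nat | D_Le nat nat | D_Add nat nat nat

primrec unit_vars :: "unit_atom \<Rightarrow> nat set" where
  "unit_vars (D_Eq i j) = {i, j}"
| "unit_vars (D_Le i j) = {i, j}"
| "unit_vars (D_Add i j k) = {i, j, k}"

primrec unit_holds :: "real list \<Rightarrow> unit_atom \<Rightarrow> bool" where
  "unit_holds xs (D_Eq i j) \<longleftrightarrow> xs ! i = xs ! j"
| "unit_holds xs (D_Le i j) \<longleftrightarrow> xs ! i \<le> xs ! j"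
| "unit_holds xs (D_Add i j k) \<longleftrightarrow> xs ! i + xs ! j = xs ! k"

definition FO_unit :: "nat \<Rightarrow> real list set set" where
  "FO_unit = definable unit_ico unit_vars unit_holds"


definition class_uplus ::
  "(nat \<Rightarrow> real list set set) \<Rightarrow> (nat \<Rightarrow> real list set set) \<Rightarrow> (nat \<Rightarrow> real list set set)"
  (infixl "\<uplus>" 65) where
  "(\<ZZ> \<uplus> \<DD>) n =
     {(\<Union>i\<in>{1..p}. sumset (Z i) (D i)) | (p::nat) Z D.
        p \<ge> 1 \<and>
        (\<forall>i\<in>{1..p}. Z i \<in> \<ZZ> n \<and> Z i \<subseteq> tuples \<int> n \<and> D i \<in> \<DD> n \<and> D i \<subseteq> tuples unit_ico n)}"

end

theory Submission
  imports Defs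
begin

text \<open>Splitting a real into its integral and its fractional part identifies the structure on
  \<open>\<real>\<close> with a structure on the product of \<open>\<int>\<close> and \<open>[0,1[\<close> in which every basic relation is a finite
  union of rectangles: \<open>x + y = z\<close> splits according to the carry of the fractional parts, and
  \<open>\<le>\<close> is lexicographic. As in the Feferman--Vaught theorem, finite unions of rectangles with
  definable sides are closed under the Boolean operations and under projection, hence contain all
  definable sets; no quantifier elimination is involved. Conversely, both parts of a real are
  definable over \<open>\<real>\<close>, so a formula about the parts can be read over \<open>\<real>\<close>.\<close>

section \<open>Classes of predicates closed under first-order operations\<close>

text \<open>Isolates what an induction over formulas needs. Both directions instantiate it: with the
  predicates definable in a fixed structure, and with the finite unions of rectangles.
  \<open>cong\<close> compares predicates on tuples over \<open>M\<close> only, since behaviour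
  outside the domain is irrelevant.\<close>

locale fo_class =
  fixes M :: "real set" and C :: "nat \<Rightarrow> (real list \<Rightarrow> bool) \<Rightarrow> bool"
  assumes cong: "C n P \<Longrightarrow> (\<And>xs. xs \<in> tuples M n \<Longrightarrow> P xs \<longleftrightarrow> Q xs) \<Longrightarrow> C n Q"
    and neg: "C n P \<Longrightarrow> C n (\<lambda>xs. \<not> P xs)"
    and conj: "C n P \<Longrightarrow> C n Q \<Longrightarrow> C n (\<lambda>xs. P xs \<and> Q xs)"
    and ex: "C (Suc n) P \<Longrightarrow> C n (\<lambda>xs. \<exists>d\<in>M. P (d # xs))"
begin

lemma disj: "C n P \<Longrightarrow> C n Q \<Longrightarrow> C n (\<lambda>xs. P xs \<or> Q xs)"
  using neg[OF conj[OF neg neg]] by simp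

lemma ex': "C (Suc n) P \<Longrightarrow> (\<And>xs. xs \<in> tuples M n \<Longrightarrow> (\<exists>d\<in>M. P (d # xs)) \<longleftrightarrow> Q xs) \<Longrightarrow> C n Q"
  using cong[OF ex] by blast

text \<open>The index set is nonempty because the closure rules all start from a given member of the
  class, so nothing provides the empty disjunction.\<close>

lemma bex_finite:
  assumes "finite I" "I \<noteq> {}" "\<And>i. i \<in> I \<Longrightarrow> C n (P i)"
  shows "C n (\<lambda>xs. \<exists>i\<in>I. P i xs)"
  using assms by (induction I rule: finite_ne_induct) (auto intro: disj)

text \<open>Since \<open>f\<close> maps \<open>M\<close> onto \<open>N\<close>, a quantifier over
  \<open>N\<close> may be replaced by one over \<open>M\<close> with \<open>f\<close> applied to the
  bound variable. With \<open>ipart\<close> and \<open>frac\<close> this reads formulas about the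
  parts over the reals; with the identity it reduces membership in a class to the atoms.\<close>

lemma sat_map:
  assumes atom: "\<And>n a. vars a \<subseteq> {..<n} \<Longrightarrow> C n (\<lambda>xs. holds (map f xs) a)"
    and surj: "f ` M = N"
  shows "scoped vars n \<phi> \<Longrightarrow> C n (\<lambda>xs. sat N holds (map f xs) \<phi>)"
proof (induction \<phi> arbitrary: n)
  case (Exists \<phi>)
  then have "C (Suc n) (\<lambda>xs. sat N holds (map f xs) \<phi>)" by simp
  from ex[OF this] show ?case by (simp flip: surj)
qed (auto intro: atom neg conj)

text \<open>The offset \<open>k\<close> leaves room for the variables bound while the term is flattened.\<close>

lemma tm_val_graph:
  assumes "M = UNIV"
    and graph: "\<And>n i j. i < n \<Longrightarrow> j < n \<Longrightarrow> C n (\<lambda>xs. xs ! i = f (xs ! j))"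
    and add: "\<And>n i j k. i < n \<Longrightarrow> j < n \<Longrightarrow> k < n \<Longrightarrow> C n (\<lambda>xs. xs ! i + xs ! j = xs ! k)"
  shows "i < k + n \<Longrightarrow> tm_vars s \<subseteq> {..<n} \<Longrightarrow>
    C (k + n) (\<lambda>xs. xs ! i = tm_val (map f (drop k xs)) s)"
proof (induction s arbitrary: i k)
  case (Var j)
  then show ?case
    by (intro cong[OF graph[of i "k + n" "k + j"]]) (auto simp: tuples_def)
next
  case (Plus s t)
  \<comment> \<open>Two fresh bound variables hold the values of the subterms, which moves variable
    \<open>i\<close> to \<open>Suc (Suc i)\<close> and the offset to \<open>Suc (Suc k)\<close>.
    These values are admissible witnesses because \<open>M = UNIV\<close>.\<close>
  have "C (Suc (Suc k) + n) (\<lambda>xs. (xs ! 1 = tm_val (map f (drop (Suc (Suc k)) xs)) s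
      \<and> xs ! 0 = tm_val (map f (drop (Suc (Suc k)) xs)) t) \<and> xs ! 1 + xs ! 0 = xs ! Suc (Suc i))"
    using Plus.prems by (intro conj Plus.IH add) auto
  from ex[OF ex[OF this[simplified]]] show ?case
    by (rule cong) (auto simp: \<open>M = UNIV\<close>)
qed

end

text \<open>The counterpart of \<open>definable\<close> for predicates, which lets closure
  properties be composed without set comprehensions over tuples.\<close>

definition expressible ::
  "real set \<Rightarrow> ('a \<Rightarrow> nat set) \<Rightarrow> (real list \<Rightarrow> 'a \<Rightarrow> bool) \<Rightarrow> nat \<Rightarrow> (real list \<Rightarrow> bool) \<Rightarrow> bool" where
  "expressible M vars holds n P \<longleftrightarrow>
     (\<exists>\<phi>. scoped vars n \<phi> \<and> (\<forall>xs\<in>tuples M n. sat M holds xs \<phi> \<longleftrightarrow> P xs))"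

lemma tuples_Cons [simp]: "d # xs \<in> tuples M (Suc n) \<longleftrightarrow> d \<in> M \<and> xs \<in> tuples M n"
  by (auto simp: tuples_def)

interpretation expressible: fo_class M "expressible M vars holds" for M vars holds
proof
  fix n P Q
  assume "expressible M vars holds n P"
  then obtain \<phi> where \<phi>: "scoped vars n \<phi>" "\<And>xs. xs \<in> tuples M n \<Longrightarrow> sat M holds xs \<phi> \<longleftrightarrow> P xs"
    by (auto simp: expressible_def)
  show "expressible M vars holds n (\<lambda>xs. \<not> P xs)"
    using \<phi> unfolding expressible_def by (intro exI[of _ "Neg \<phi>"]) simp
  show "expressible M vars holds n Q" if "\<And>xs. xs \<in> tuples M n \<Longrightarrow> P xs \<longleftrightarrow> Q xs"
    using \<phi> that unfolding expressible_def by (intro exI[of _ \<phi>]) simp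
  show "expressible M vars holds n (\<lambda>xs. P xs \<and> Q xs)" if "expressible M vars holds n Q"
  proof -
    from that obtain \<psi> where "scoped vars n \<psi>" "\<And>xs. xs \<in> tuples M n \<Longrightarrow> sat M holds xs \<psi> \<longleftrightarrow> Q xs"
      by (auto simp: expressible_def)
    with \<phi> show ?thesis unfolding expressible_def by (intro exI[of _ "Conj \<phi> \<psi>"]) simp
  qed
next
  fix n P
  assume "expressible M vars holds (Suc n) P"
  then obtain \<phi> where
    "scoped vars (Suc n) \<phi>" "\<And>xs. xs \<in> tuples M (Suc n) \<Longrightarrow> sat M holds xs \<phi> \<longleftrightarrow> P xs"
    by (auto simp: expressible_def)
  then show "expressible M vars holds n (\<lambda>xs. \<exists>d\<in>M. P (d # xs))"
    unfolding expressible_def by (intro exI[of _ "Exists \<phi>"]) auto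
qed

lemma expressible_atom: "vars a \<subseteq> {..<n} \<Longrightarrow> expressible M vars holds n (\<lambda>xs. holds xs a)"
  unfolding expressible_def by (intro exI[of _ "Atom a"]) simp

lemma definable_iff:
  "R \<in> definable M vars holds n \<longleftrightarrow> R \<subseteq> tuples M n \<and> expressible M vars holds n (\<lambda>xs. xs \<in> R)"
  unfolding definable_def expressible_def by blast

abbreviation "real_expressible \<equiv> expressible UNIV real_int_vars real_int_holds"
abbreviation "int_expressible \<equiv> expressible \<int> int_vars int_holds"
abbreviation "unit_expressible \<equiv> expressible unit_ico unit_vars unit_holds"

section \<open>Integral and fractional parts\<close>

abbreviation ipart :: "real \<Rightarrow> real" where
  "ipart x \<equiv> of_int \<lfloor>x\<rfloor>"

lemma image_ipart: "range ipart = \<int>"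
  by (auto simp: Ints_def image_iff) (metis floor_of_int)

lemma image_frac: "range frac = unit_ico"
  by (auto simp: unit_ico_def image_iff frac_lt_1) (metis frac_eq)

lemma map_ipart_tuples: "xs \<in> tuples UNIV n \<Longrightarrow> map ipart xs \<in> tuples \<int> n"
  by (auto simp: tuples_def)

lemma map_frac_tuples: "xs \<in> tuples UNIV n \<Longrightarrow> map frac xs \<in> tuples unit_ico n"
  by (auto simp: tuples_def unit_ico_def frac_lt_1)

lemma add_unit_unique:
  assumes "z \<in> \<int>" "d \<in> unit_ico"
  shows "ipart (z + d) = z" "frac (z + d) = d"
proof -
  obtain k where "z = of_int k" using assms(1) by (auto elim: Ints_cases)
  moreover have "\<lfloor>of_int k + d\<rfloor> = k" using assms(2) by (auto simp: unit_ico_def floor_eq_iff)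
  ultimately show "ipart (z + d) = z" "frac (z + d) = d" by (auto simp: frac_def)
qed

lemma floor_unit: "d \<in> unit_ico \<Longrightarrow> \<lfloor>d\<rfloor> = 0"
  by (auto simp: unit_ico_def floor_eq_iff)

text \<open>Any integer \<open>z\<close> and any \<open>d\<close> in the unit interval are the parts
  of the single real \<open>z + d\<close>, so the two parts can be chosen independently. This is why
  the projection of a rectangle is a rectangle.\<close>

lemma ex_real_iff:
  "(\<exists>x::real. P (ipart x) \<and> Q (frac x)) \<longleftrightarrow> (\<exists>z\<in>\<int>. P z) \<and> (\<exists>d\<in>unit_ico. Q d)"
proof
  assume "\<exists>x::real. P (ipart x) \<and> Q (frac x)"
  then show "(\<exists>z\<in>\<int>. P z) \<and> (\<exists>d\<in>unit_ico. Q d)" using image_frac by auto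
next
  assume "(\<exists>z\<in>\<int>. P z) \<and> (\<exists>d\<in>unit_ico. Q d)"
  then show "\<exists>x::real. P (ipart x) \<and> Q (frac x)" by (metis add_unit_unique)
qed

text \<open>The decomposition of each coordinate is unique, so a sum of sets is a rectangle in the
  coordinates given by the parts.\<close>

lemma mem_sumset_iff:
  assumes "Z \<subseteq> tuples \<int> n" "D \<subseteq> tuples unit_ico n"
  shows "xs \<in> sumset Z D \<longleftrightarrow> map ipart xs \<in> Z \<and> map frac xs \<in> D"
proof
  assume "xs \<in> sumset Z D"
  then obtain a b where ab: "xs = map2 (+) a b" "a \<in> Z" "b \<in> D" by (auto simp: sumset_def)
  then have *: "length a = length b" "set a \<subseteq> \<int>" "set b \<subseteq> unit_ico"
    using assms by (auto simp: tuples_def)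
  have "map ipart (map2 (+) a b) = a \<and> map frac (map2 (+) a b) = b"
    using * by (induction a b rule: list_induct2) (simp_all add: add_unit_unique floor_unit)
  then show "map ipart xs \<in> Z \<and> map frac xs \<in> D" using ab by metis
next
  assume "map ipart xs \<in> Z \<and> map frac xs \<in> D"
  moreover have "xs = map2 (+) (map ipart xs) (map frac xs)"
    by (induction xs) (auto simp: frac_def)
  ultimately show "xs \<in> sumset Z D" unfolding sumset_def by blast
qed

lemma ipart_frac_le: "(x::real) \<le> y \<longleftrightarrow> ipart x < ipart y \<or> ipart x = ipart y \<and> frac x \<le> frac y"
proof -
  consider "\<lfloor>x\<rfloor> < \<lfloor>y\<rfloor>" | "\<lfloor>x\<rfloor> = \<lfloor>y\<rfloor>" | "\<lfloor>y\<rfloor> < \<lfloor>x\<rfloor>" by linarith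
  then show ?thesis
  proof cases
    case 1
    then have "x \<le> y" by linarith
    with 1 show ?thesis by simp
  next
    case 2
    then show ?thesis by (simp add: frac_def)
  next
    case 3
    then have "\<not> x \<le> y" by linarith
    with 3 show ?thesis by simp
  qed
qed

lemma ipart_frac_add:
  fixes x y z :: real
  shows "x + y = z \<longleftrightarrow> ipart x + ipart y = ipart z \<and> frac x + frac y = frac z
    \<or> ipart x + ipart y + 1 = ipart z \<and> frac x + frac y = 1 + frac z"
proof
  assume z: "x + y = z"
  \<comment> \<open>The fractional parts add up to less than 2, so the carry is 0 or 1.\<close>
  have "\<lfloor>z\<rfloor> = \<lfloor>x\<rfloor> + \<lfloor>y\<rfloor> \<or> \<lfloor>z\<rfloor> = \<lfloor>x\<rfloor> + \<lfloor>y\<rfloor> + 1" using z by linarith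
  then show "ipart x + ipart y = ipart z \<and> frac x + frac y = frac z
    \<or> ipart x + ipart y + 1 = ipart z \<and> frac x + frac y = 1 + frac z"
    using z by (auto simp: frac_def)
qed (auto simp: frac_def)

section \<open>Definability over the reals of sums of parts\<close>

lemma real_expressible_le: "i < n \<Longrightarrow> j < n \<Longrightarrow> real_expressible n (\<lambda>xs. xs ! i \<le> xs ! j)"
  using expressible_atom[of real_int_vars "RZ_Le (Var i) (Var j)" n UNIV real_int_holds] by simp

lemma real_expressible_eq: "i < n \<Longrightarrow> j < n \<Longrightarrow> real_expressible n (\<lambda>xs. xs ! i = xs ! j)"
  using expressible_atom[of real_int_vars "RZ_Eq (Var i) (Var j)" n UNIV real_int_holds] by simp

lemma real_expressible_Ints: "i < n \<Longrightarrow> real_expressible n (\<lambda>xs. xs ! i \<in> \<int>)"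
  using expressible_atom[of real_int_vars "RZ_Int (Var i)" n UNIV real_int_holds] by simp

lemma real_expressible_add:
  "i < n \<Longrightarrow> j < n \<Longrightarrow> k < n \<Longrightarrow> real_expressible n (\<lambda>xs. xs ! i + xs ! j = xs ! k)"
  using expressible_atom[of real_int_vars "RZ_Eq (Plus (Var i) (Var j)) (Var k)" n UNIV real_int_holds]
  by simp

text \<open>Characterises the floor as the greatest integer not above \<open>x\<close>, written only
  with atoms, negation, conjunction and an existential so that the closure rules apply
  directly.\<close>

lemma ipart_eq_iff: "y = ipart x \<longleftrightarrow> (y \<in> \<int> \<and> y \<le> x) \<and> \<not> (\<exists>z\<in>UNIV. (z \<in> \<int> \<and> z \<le> x) \<and> \<not> z \<le> y)"
proof
  assume *: "(y \<in> \<int> \<and> y \<le> x) \<and> \<not> (\<exists>z\<in>UNIV. (z \<in> \<int> \<and> z \<le> x) \<and> \<not> z \<le> y)"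
  then have "ipart x \<le> y" "y \<le> ipart x"
    by (meson Ints_of_int UNIV_I of_int_floor_le) (use * in \<open>auto elim!: Ints_cases simp: le_floor_iff\<close>)
  then show "y = ipart x" by (rule antisym[rotated])
qed (auto elim!: Ints_cases simp: le_floor_iff)

lemma real_expressible_ipart:
  assumes "i < n" "j < n"
  shows "real_expressible n (\<lambda>xs. xs ! i = ipart (xs ! j))"
proof -
  have "real_expressible (Suc n) (\<lambda>xs. (xs ! 0 \<in> \<int> \<and> xs ! 0 \<le> xs ! Suc j) \<and> \<not> xs ! 0 \<le> xs ! Suc i)"
    using assms by (intro expressible.conj expressible.neg real_expressible_le real_expressible_Ints) auto
  note expressible.ex[OF this, simplified nth_Cons_0 nth_Cons_Suc]
  then show ?thesis
    unfolding ipart_eq_iff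
    using assms by (intro expressible.conj expressible.neg real_expressible_le real_expressible_Ints) auto
qed

lemma real_expressible_frac:
  assumes "i < n" "j < n"
  shows "real_expressible n (\<lambda>xs. xs ! i = frac (xs ! j))"
proof (rule expressible.ex')
  show "real_expressible (Suc n) (\<lambda>xs. xs ! 0 = ipart (xs ! Suc j) \<and> xs ! 0 + xs ! Suc i = xs ! Suc j)"
    using assms by (intro expressible.conj real_expressible_ipart real_expressible_add) auto
qed (auto simp: frac_def)

lemma real_expressible_tm:
  assumes "i < k + n" "tm_vars s \<subseteq> {..<n}"
  shows "real_expressible (k + n) (\<lambda>xs. xs ! i = tm_val (map ipart (drop k xs)) s)"
  using assms by (intro expressible.tm_val_graph real_expressible_ipart real_expressible_add) auto

lemma real_expressible_int_atom:
  assumes "int_vars a \<subseteq> {..<n}"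
  shows "real_expressible n (\<lambda>xs. int_holds (map ipart xs) a)"
proof -
  \<comment> \<open>Variables 0 and 1 name the values of the two terms; \<open>P\<close> is then the
    relation of the atom between these two variables.\<close>
  have *: "real_expressible (2 + n) (\<lambda>xs. (xs ! 0 = tm_val (map ipart (drop 2 xs)) s
      \<and> xs ! 1 = tm_val (map ipart (drop 2 xs)) t) \<and> P xs)"
    if "tm_vars s \<union> tm_vars t \<subseteq> {..<n}" "real_expressible (2 + n) P" for s t P
    using that by (intro expressible.conj real_expressible_tm) auto
  show ?thesis
  proof (cases a)
    case (Z_Eq s t)
    have "real_expressible (2 + n) (\<lambda>xs. xs ! 0 = xs ! 1)" by (rule real_expressible_eq) auto
    from expressible.ex[OF expressible.ex[OF *[OF _ this, of s t, simplified]]] show ?thesis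
      using assms Z_Eq by auto
  next
    case (Z_Le s t)
    have "real_expressible (2 + n) (\<lambda>xs. xs ! 0 \<le> xs ! 1)" by (rule real_expressible_le) auto
    from expressible.ex[OF expressible.ex[OF *[OF _ this, of s t, simplified]]] show ?thesis
      using assms Z_Le by auto
  qed
qed

text \<open>The arguments are variables, so it suffices to name their fractional parts by bound
  variables and to state the relation between those.\<close>

lemma real_expressible_unit_atom:
  assumes "unit_vars a \<subseteq> {..<n}"
  shows "real_expressible n (\<lambda>xs. unit_holds (map frac xs) a)"
proof (cases a)
  case (D_Eq i j)
  have "real_expressible (Suc n) (\<lambda>xs. xs ! 0 = frac (xs ! Suc i) \<and> xs ! 0 = frac (xs ! Suc j))"
    using assms D_Eq by (intro expressible.conj real_expressible_frac) auto
  from expressible.ex[OF this] show ?thesis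
    by (rule expressible.cong) (use assms D_Eq in \<open>auto simp: tuples_def\<close>)
next
  case (D_Le i j)
  have "real_expressible (Suc (Suc n)) (\<lambda>xs. (xs ! 0 = frac (xs ! Suc (Suc i))
      \<and> xs ! 1 = frac (xs ! Suc (Suc j))) \<and> xs ! 0 \<le> xs ! 1)"
    using assms D_Le by (intro expressible.conj real_expressible_frac real_expressible_le) auto
  from expressible.ex[OF expressible.ex[OF this]] show ?thesis
    by (rule expressible.cong) (use assms D_Le in \<open>auto simp: tuples_def\<close>)
next
  case (D_Add i j k)
  have "real_expressible (Suc (Suc (Suc n))) (\<lambda>xs. ((xs ! 0 = frac (xs ! Suc (Suc (Suc i)))
      \<and> xs ! 1 = frac (xs ! Suc (Suc (Suc j)))) \<and> xs ! 2 = frac (xs ! Suc (Suc (Suc k))))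
      \<and> xs ! 0 + xs ! 1 = xs ! 2)"
    using assms D_Add by (intro expressible.conj real_expressible_frac real_expressible_add) auto
  from expressible.ex[OF expressible.ex[OF expressible.ex[OF this]]] show ?thesis
    by (rule expressible.cong) (use assms D_Add in \<open>auto simp: tuples_def\<close>)
qed

lemma real_expressible_sumset:
  assumes "Z \<in> FO_int n" "D \<in> FO_unit n"
  shows "real_expressible n (\<lambda>xs. xs \<in> sumset Z D)"
proof -
  from assms obtain \<phi> \<psi> where \<phi>: "scoped int_vars n \<phi>" "Z = {xs \<in> tuples \<int> n. sat \<int> int_holds xs \<phi>}"
    and \<psi>: "scoped unit_vars n \<psi>" "D = {xs \<in> tuples unit_ico n. sat unit_ico unit_holds xs \<psi>}"
    by (auto simp: FO_int_def FO_unit_def definable_def)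
  have "real_expressible n (\<lambda>xs. sat \<int> int_holds (map ipart xs) \<phi> \<and> sat unit_ico unit_holds (map frac xs) \<psi>)"
    using \<phi>(1) \<psi>(1)
    by (intro expressible.conj expressible.sat_map[OF real_expressible_int_atom image_ipart]
        expressible.sat_map[OF real_expressible_unit_atom image_frac])
  then show ?thesis
  proof (rule expressible.cong)
    fix xs :: "real list" assume "xs \<in> tuples UNIV n"
    then show "sat \<int> int_holds (map ipart xs) \<phi> \<and> sat unit_ico unit_holds (map frac xs) \<psi>
        \<longleftrightarrow> xs \<in> sumset Z D"
      using mem_sumset_iff[of Z n D xs] map_ipart_tuples[of xs n] map_frac_tuples[of xs n]
      by (auto simp: \<phi>(2) \<psi>(2))
  qed
qed

section \<open>Finite unions of rectangles\<close>

text \<open>A rectangle is given by a pair of formulas rather than of sets, so that intersection and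
  projection act on syntax and keep definability for free.\<close>

definition in_rect :: "real list \<Rightarrow> int_atom form \<times> unit_atom form \<Rightarrow> bool" where
  "in_rect xs r \<longleftrightarrow> sat \<int> int_holds (map ipart xs) (fst r) \<and> sat unit_ico unit_holds (map frac xs) (snd r)"

definition rects :: "nat \<Rightarrow> (int_atom form \<times> unit_atom form) set" where
  "rects n = {r. scoped int_vars n (fst r) \<and> scoped unit_vars n (snd r)}"

definition rect_union :: "nat \<Rightarrow> (real list \<Rightarrow> bool) \<Rightarrow> bool" where
  "rect_union n P \<longleftrightarrow> (\<exists>L. finite L \<and> L \<subseteq> rects n \<and>
     (\<forall>xs\<in>tuples UNIV n. P xs \<longleftrightarrow> (\<exists>r\<in>L. in_rect xs r)))"

lemma rect_unionE:
  assumes "rect_union n P"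
  obtains L where "finite L" "L \<subseteq> rects n"
    "\<And>xs. xs \<in> tuples UNIV n \<Longrightarrow> P xs \<longleftrightarrow> (\<exists>r\<in>L. in_rect xs r)"
  using assms unfolding rect_union_def by blast

text \<open>Provides a full side for a rectangle. There is no truth constant and, in dimension 0, no
  free variable, so the tautology is quantified; this uses that the domain is nonempty.\<close>

lemma int_expressible_True: "int_expressible n (\<lambda>xs. True)"
  using expressible.ex[OF expressible_atom[of int_vars "Z_Eq (Var 0) (Var 0)" "Suc n" \<int> int_holds]]
  by (auto intro: Ints_0 elim!: expressible.cong)

lemma unit_expressible_True: "unit_expressible n (\<lambda>xs. True)"
proof -
  have "\<exists>d. d \<in> unit_ico" by (auto simp: unit_ico_def intro: exI[of _ 0])
  then show ?thesis
    using expressible.ex[OF expressible_atom[of unit_vars "D_Eq 0 0" "Suc n" unit_ico unit_holds]] by auto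
qed

lemma rect_union_rect:
  assumes "int_expressible n P" "unit_expressible n Q"
  shows "rect_union n (\<lambda>xs. P (map ipart xs) \<and> Q (map frac xs))"
proof -
  from assms obtain \<phi> \<psi> where
    "scoped int_vars n \<phi>" "\<And>xs. xs \<in> tuples \<int> n \<Longrightarrow> sat \<int> int_holds xs \<phi> \<longleftrightarrow> P xs"
    "scoped unit_vars n \<psi>" "\<And>xs. xs \<in> tuples unit_ico n \<Longrightarrow> sat unit_ico unit_holds xs \<psi> \<longleftrightarrow> Q xs"
    unfolding expressible_def by blast
  then show ?thesis
    unfolding rect_union_def
    by (intro exI[of _ "{(\<phi>, \<psi>)}"])
      (auto simp: rects_def in_rect_def dest: map_ipart_tuples map_frac_tuples)
qed

lemma rect_union_ipart: "int_expressible n P \<Longrightarrow> rect_union n (\<lambda>xs. P (map ipart xs))"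
  using rect_union_rect[OF _ unit_expressible_True] by simp

lemma rect_union_frac: "unit_expressible n Q \<Longrightarrow> rect_union n (\<lambda>xs. Q (map frac xs))"
  using rect_union_rect[OF int_expressible_True] by simp

lemma rect_union_cong:
  "rect_union n P \<Longrightarrow> (\<And>xs. xs \<in> tuples UNIV n \<Longrightarrow> P xs \<longleftrightarrow> Q xs) \<Longrightarrow> rect_union n Q"
  unfolding rect_union_def by simp

text \<open>Proved directly, because the locale derives disjunction from negation, whereas closure
  under negation here rests on disjunction.\<close>

lemma rect_union_disj:
  assumes "rect_union n P" "rect_union n Q"
  shows "rect_union n (\<lambda>xs. P xs \<or> Q xs)"
proof -
  from assms(1) obtain L where L: "finite L" "L \<subseteq> rects n"
    "\<And>xs. xs \<in> tuples UNIV n \<Longrightarrow> P xs \<longleftrightarrow> (\<exists>r\<in>L. in_rect xs r)" by (rule rect_unionE) blast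
  from assms(2) obtain L' where L': "finite L'" "L' \<subseteq> rects n"
    "\<And>xs. xs \<in> tuples UNIV n \<Longrightarrow> Q xs \<longleftrightarrow> (\<exists>r\<in>L'. in_rect xs r)" by (rule rect_unionE) blast
  from L L' show ?thesis unfolding rect_union_def by (intro exI[of _ "L \<union> L'"]) auto
qed

text \<open>Intersection distributes over unions, and two rectangles are intersected side by
  side.\<close>

lemma rect_union_conj:
  assumes "rect_union n P" "rect_union n Q"
  shows "rect_union n (\<lambda>xs. P xs \<and> Q xs)"
proof -
  from assms(1) obtain L where L: "finite L" "L \<subseteq> rects n"
    "\<And>xs. xs \<in> tuples UNIV n \<Longrightarrow> P xs \<longleftrightarrow> (\<exists>r\<in>L. in_rect xs r)" by (rule rect_unionE) blast
  from assms(2) obtain L' where L': "finite L'" "L' \<subseteq> rects n"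
    "\<And>xs. xs \<in> tuples UNIV n \<Longrightarrow> Q xs \<longleftrightarrow> (\<exists>r\<in>L'. in_rect xs r)" by (rule rect_unionE) blast
  define meet :: "(int_atom form \<times> unit_atom form) \<times> (int_atom form \<times> unit_atom form) \<Rightarrow> _"
    where "meet = (\<lambda>(r, r'). (Conj (fst r) (fst r'), Conj (snd r) (snd r')))"
  have "in_rect xs (meet (r, r')) \<longleftrightarrow> in_rect xs r \<and> in_rect xs r'" for xs r r'
    by (auto simp: meet_def in_rect_def)
  moreover have "meet ` (L \<times> L') \<subseteq> rects n"
    using L(2) L'(2) by (fastforce simp: meet_def rects_def)
  ultimately show ?thesis
    using L L' unfolding rect_union_def by (intro exI[of _ "meet ` (L \<times> L')"]) auto
qed

text \<open>A point misses a rectangle iff it misses one of the sides, so the complement of a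
  rectangle is a union of two; the complement of a finite union is the intersection of such
  complements.\<close>

lemma rect_union_neg:
  assumes "rect_union n P"
  shows "rect_union n (\<lambda>xs. \<not> P xs)"
proof -
  have "rect_union n (\<lambda>xs. \<not> (\<exists>r\<in>L. in_rect xs r))" if "finite L" "L \<subseteq> rects n" for L
    using that
  proof induction
    case empty
    then show ?case using rect_union_ipart[OF int_expressible_True] by simp
  next
    case (insert r L)
    have "int_expressible n (\<lambda>xs. \<not> sat \<int> int_holds xs (fst r))"
      and "unit_expressible n (\<lambda>xs. \<not> sat unit_ico unit_holds xs (snd r))"
      using insert.prems by (auto simp: expressible_def rects_def intro: exI[of _ "Neg _"])
    from rect_union_disj[OF rect_union_ipart[OF this(1)] rect_union_frac[OF this(2)]]
    have "rect_union n (\<lambda>xs. \<not> in_rect xs r)" by (simp add: in_rect_def)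
    from rect_union_conj[OF this insert.IH] show ?case using insert.prems by simp
  qed
  moreover from assms obtain L where "finite L" "L \<subseteq> rects n"
    "\<And>xs. xs \<in> tuples UNIV n \<Longrightarrow> P xs \<longleftrightarrow> (\<exists>r\<in>L. in_rect xs r)" by (rule rect_unionE) blast
  ultimately show ?thesis by (fastforce elim: rect_union_cong)
qed

text \<open>Projection commutes with unions, and by \<open>ex_real_iff\<close> it acts on the two
  sides of a rectangle separately.\<close>

lemma rect_union_ex:
  assumes "rect_union (Suc n) P"
  shows "rect_union n (\<lambda>xs. \<exists>x\<in>UNIV. P (x # xs))"
proof -
  from assms obtain L where L: "finite L" "L \<subseteq> rects (Suc n)"
    "\<And>xs. xs \<in> tuples UNIV (Suc n) \<Longrightarrow> P xs \<longleftrightarrow> (\<exists>r\<in>L. in_rect xs r)" by (rule rect_unionE) blast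
  define proj :: "int_atom form \<times> unit_atom form \<Rightarrow> _"
    where "proj = (\<lambda>r. (Exists (fst r), Exists (snd r)))"
  have "in_rect xs (proj r) \<longleftrightarrow> (\<exists>x. in_rect (x # xs) r)" for xs r
    using ex_real_iff[of "\<lambda>z. sat \<int> int_holds (z # map ipart xs) (fst r)"
        "\<lambda>d. sat unit_ico unit_holds (d # map frac xs) (snd r)"]
    by (simp add: proj_def in_rect_def)
  moreover have "proj ` L \<subseteq> rects n" using L(2) by (auto simp: proj_def rects_def)
  ultimately show ?thesis
    using L(1,3) unfolding rect_union_def by (intro exI[of _ "proj ` L"]) auto
qed

interpretation rect_union: fo_class UNIV rect_union
  by standard (fact rect_union_cong rect_union_neg rect_union_conj rect_union_ex)+

section \<open>The basic relations on reals are unions of rectangles\<close>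

lemma int_expressible_eq: "tm_vars s \<union> tm_vars t \<subseteq> {..<n} \<Longrightarrow> int_expressible n (\<lambda>xs. tm_val xs s = tm_val xs t)"
  using expressible_atom[of int_vars "Z_Eq s t" n \<int> int_holds] by simp

lemma int_expressible_less: "tm_vars s \<union> tm_vars t \<subseteq> {..<n} \<Longrightarrow> int_expressible n (\<lambda>xs. tm_val xs s < tm_val xs t)"
  using expressible.neg[OF expressible_atom[of int_vars "Z_Le t s" n \<int> int_holds]] by (simp add: not_le Un_commute)

text \<open>The language has no constant 1, so adding the carry is expressed as passing to the next
  integer in the order.\<close>

lemma Ints_eq_add1_iff:
  fixes a b :: real
  assumes "a \<in> \<int>" "b \<in> \<int>"
  shows "a + 1 = b \<longleftrightarrow> a < b \<and> \<not> (\<exists>w\<in>\<int>. a < w \<and> w < b)"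
proof
  assume "a < b \<and> \<not> (\<exists>w\<in>\<int>. a < w \<and> w < b)"
  moreover have "a + 1 \<in> \<int>" using assms by simp
  ultimately have "a < b" "\<not> a + 1 < b" by (auto dest: bspec)
  with assms show "a + 1 = b" by (auto elim!: Ints_cases)
next
  assume b: "a + 1 = b"
  have "\<not> (a < w \<and> w < a + 1)" if "w \<in> \<int>" for w
  proof -
    from that assms(1) obtain k l where "a = of_int k" "w = of_int l" by (auto elim!: Ints_cases)
    then show ?thesis using of_int_less_iff[of l "k + 1", where 'a = real] by auto
  qed
  with b show "a < b \<and> \<not> (\<exists>w\<in>\<int>. a < w \<and> w < b)" by auto
qed

lemma int_expressible_add1:
  assumes "i < n" "j < n" "k < n"
  shows "int_expressible n (\<lambda>xs. xs ! i + xs ! j + 1 = xs ! k)"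
proof -
  have "int_expressible (Suc n) (\<lambda>xs. tm_val xs (Plus (Var (Suc i)) (Var (Suc j))) < tm_val xs (Var 0)
      \<and> tm_val xs (Var 0) < tm_val xs (Var (Suc k)))"
    using assms by (intro expressible.conj int_expressible_less) auto
  from expressible.neg[OF expressible.ex[OF this]]
  have "int_expressible n (\<lambda>xs. tm_val xs (Plus (Var i) (Var j)) < tm_val xs (Var k)
      \<and> \<not> (\<exists>w\<in>\<int>. xs ! i + xs ! j < w \<and> w < xs ! k))"
    using assms by (intro expressible.conj int_expressible_less) auto
  then show ?thesis
    by (rule expressible.cong) (use assms in \<open>subst Ints_eq_add1_iff, auto simp: tuples_def subset_iff\<close>)
qed

section \<open>Addition with carry inside the unit interval\<close>

lemma unit_expressible_le: "i < n \<Longrightarrow> j < n \<Longrightarrow> unit_expressible n (\<lambda>xs. xs ! i \<le> xs ! j)"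
  using expressible_atom[of unit_vars "D_Le i j" n unit_ico unit_holds] by simp

lemma unit_expressible_add: "i < n \<Longrightarrow> j < n \<Longrightarrow> k < n \<Longrightarrow> unit_expressible n (\<lambda>xs. xs ! i + xs ! j = xs ! k)"
  using expressible_atom[of unit_vars "D_Add i j k" n unit_ico unit_holds] by simp

text \<open>A sum of two elements is below 1 exactly when it is itself an element of the
  domain.\<close>

lemma unit_expressible_add_less1:
  assumes "i < n" "j < n"
  shows "unit_expressible n (\<lambda>xs. xs ! i + xs ! j < 1)"
proof (rule expressible.ex')
  show "unit_expressible (Suc n) (\<lambda>xs. xs ! Suc i + xs ! Suc j = xs ! 0)"
    using assms by (intro unit_expressible_add) auto
qed (use assms in \<open>auto simp: tuples_def unit_ico_def subset_iff\<close>)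

text \<open>The number 1 lies outside the domain, so \<open>e + d = 1\<close> is expressed by saying that \<open>e\<close> is the
  least element whose sum with \<open>d\<close> leaves the domain.\<close>

lemma unit_add_eq1_iff:
  assumes "e \<in> unit_ico" "d \<in> unit_ico"
  shows "e + d = 1 \<longleftrightarrow> \<not> e + d < 1 \<and> \<not> (\<exists>e'\<in>unit_ico. \<not> e \<le> e' \<and> \<not> e' + d < 1)"
proof
  assume *: "\<not> e + d < 1 \<and> \<not> (\<exists>e'\<in>unit_ico. \<not> e \<le> e' \<and> \<not> e' + d < 1)"
  \<comment> \<open>From \<open>e < 1\<close> and \<open>e + d \<ge> 1\<close> follows
    \<open>d > 0\<close>, hence \<open>1 - d < 1\<close>.\<close>
  then have "1 - d \<in> unit_ico" using assms by (auto simp: unit_ico_def)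
  with * have "e \<le> 1 - d" by auto
  with * show "e + d = 1" by auto
qed auto

lemma unit_expressible_add_eq1:
  assumes "i < n" "j < n"
  shows "unit_expressible n (\<lambda>xs. xs ! i + xs ! j = 1)"
proof -
  have "unit_expressible (Suc n) (\<lambda>xs. \<not> xs ! Suc i \<le> xs ! 0 \<and> \<not> xs ! 0 + xs ! Suc j < 1)"
    using assms by (intro expressible.conj expressible.neg unit_expressible_le unit_expressible_add_less1) auto
  from expressible.conj[OF expressible.neg[OF unit_expressible_add_less1[OF assms]]
      expressible.neg[OF expressible.ex[OF this]]]
  show ?thesis
    by (rule expressible.cong) (use assms in \<open>subst unit_add_eq1_iff, auto simp: tuples_def subset_iff\<close>)
qed

text \<open>For \<open>x + y = 1 + z\<close>, the witness \<open>e = 1 - y = x - z\<close> lies in the domain although \<open>x + y\<close> does not.\<close>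

lemma unit_expressible_carry:
  assumes "i < n" "j < n" "k < n"
  shows "unit_expressible n (\<lambda>xs. xs ! i + xs ! j = 1 + xs ! k)"
proof (rule expressible.ex')
  show "unit_expressible (Suc n) (\<lambda>xs. xs ! 0 + xs ! Suc j = 1 \<and> xs ! 0 + xs ! Suc k = xs ! Suc i)"
    using assms by (intro expressible.conj unit_expressible_add unit_expressible_add_eq1) auto
next
  fix xs assume "xs \<in> tuples unit_ico n"
  then have *: "xs ! i \<in> unit_ico" "xs ! j \<in> unit_ico" "xs ! k \<in> unit_ico"
    using assms by (auto simp: tuples_def subset_iff)
  have "1 - xs ! j \<in> unit_ico" if "xs ! i + xs ! j = 1 + xs ! k"
    using that * by (auto simp: unit_ico_def)
  then show "(\<exists>e\<in>unit_ico. (e # xs) ! 0 + (e # xs) ! Suc j = 1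
      \<and> (e # xs) ! 0 + (e # xs) ! Suc k = (e # xs) ! Suc i) \<longleftrightarrow> xs ! i + xs ! j = 1 + xs ! k"
    by (auto intro!: bexI[of _ "1 - xs ! j"])
qed

section \<open>Atoms over the reals as unions of rectangles\<close>

lemma rect_union_le:
  assumes "i < n" "j < n"
  shows "rect_union n (\<lambda>xs. xs ! i \<le> xs ! j)"
proof -
  have "rect_union n (\<lambda>xs. (tm_val (map ipart xs) (Var i) < tm_val (map ipart xs) (Var j)) \<or>
      (tm_val (map ipart xs) (Var i) = tm_val (map ipart xs) (Var j) \<and> map frac xs ! i \<le> map frac xs ! j))"
    using assms
    by (intro rect_union.disj rect_union_ipart[where P = "\<lambda>ys. tm_val ys (Var i) < tm_val ys (Var j)"]
        rect_union_rect[where P = "\<lambda>ys. tm_val ys (Var i) = tm_val ys (Var j)" and Q = "\<lambda>ys. ys ! i \<le> ys ! j"]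
        int_expressible_less int_expressible_eq unit_expressible_le) auto
  then show ?thesis
    by (rule rect_union.cong)
      (use assms in \<open>auto simp: tuples_def ipart_frac_le[of "_ ! i" "_ ! j"]\<close>)
qed

lemma rect_union_eq:
  assumes "i < n" "j < n"
  shows "rect_union n (\<lambda>xs. xs ! i = xs ! j)"
  by (rule rect_union.cong[OF rect_union.conj[OF rect_union_le[of i n j] rect_union_le[of j n i]]])
    (use assms in auto)

text \<open>One rectangle for each value of the carry.\<close>

lemma rect_union_add:
  assumes "i < n" "j < n" "k < n"
  shows "rect_union n (\<lambda>xs. xs ! i + xs ! j = xs ! k)"
proof -
  have "int_expressible n (\<lambda>xs. tm_val xs (Plus (Var i) (Var j)) = tm_val xs (Var k))"
    using assms by (intro int_expressible_eq) auto
  then have "int_expressible n (\<lambda>xs. xs ! i + xs ! j = xs ! k)" by simp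
  note rect_union.disj[OF rect_union_rect[OF this unit_expressible_add[OF assms]]
      rect_union_rect[OF int_expressible_add1[OF assms] unit_expressible_carry[OF assms]]]
  then show ?thesis
    by (rule rect_union.cong)
      (use assms in \<open>auto simp: tuples_def ipart_frac_add[of "_ ! i" "_ ! j" "_ ! k"]\<close>)
qed

text \<open>A real is an integer iff its fractional part is 0, and 0 is the only solution of
  \<open>d + d = d\<close>.\<close>

lemma rect_union_Ints:
  assumes "i < n"
  shows "rect_union n (\<lambda>xs. xs ! i \<in> \<int>)"
  by (rule rect_union.cong[OF rect_union_frac[OF unit_expressible_add[of i n i i]]])
    (use assms in \<open>auto simp: tuples_def\<close>)

lemma rect_union_tm:
  assumes "i < k + n" "tm_vars s \<subseteq> {..<n}"
  shows "rect_union (k + n) (\<lambda>xs. xs ! i = tm_val (drop k xs) s)"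
  using rect_union.tm_val_graph[of "\<lambda>x. x", OF _ rect_union_eq rect_union_add assms] by simp

lemma rect_union_atom:
  assumes "real_int_vars a \<subseteq> {..<n}"
  shows "rect_union n (\<lambda>xs. real_int_holds xs a)"
proof -
  have *: "rect_union (2 + n) (\<lambda>xs. (xs ! 0 = tm_val (drop 2 xs) s
      \<and> xs ! 1 = tm_val (drop 2 xs) t) \<and> P xs)"
    if "tm_vars s \<union> tm_vars t \<subseteq> {..<n}" "rect_union (2 + n) P" for s t P
    using that by (intro rect_union.conj rect_union_tm) auto
  show ?thesis
  proof (cases a)
    case (RZ_Eq s t)
    have "rect_union (2 + n) (\<lambda>xs. xs ! 0 = xs ! 1)" by (rule rect_union_eq) auto
    from rect_union.ex[OF rect_union.ex[OF *[OF _ this, of s t, simplified]]] show ?thesis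
      using assms RZ_Eq by auto
  next
    case (RZ_Le s t)
    have "rect_union (2 + n) (\<lambda>xs. xs ! 0 \<le> xs ! 1)" by (rule rect_union_le) auto
    from rect_union.ex[OF rect_union.ex[OF *[OF _ this, of s t, simplified]]] show ?thesis
      using assms RZ_Le by auto
  next
    case (RZ_Int t)
    have "rect_union (1 + n) (\<lambda>xs. xs ! 0 = tm_val (drop 1 xs) t \<and> xs ! 0 \<in> \<int>)"
      using assms RZ_Int by (intro rect_union.conj rect_union_tm rect_union_Ints) auto
    from rect_union.ex[OF this[simplified]] show ?thesis using RZ_Int by auto
  qed
qed

lemma rect_union_sat:
  "scoped real_int_vars n \<phi> \<Longrightarrow> rect_union n (\<lambda>xs. sat UNIV real_int_holds xs \<phi>)"
  using rect_union.sat_map[of real_int_vars real_int_holds "\<lambda>x. x"] rect_union_atom by simp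

section \<open>The two inclusions\<close>

lemma FO_real_int_subset: "FO_real_int n \<subseteq> (FO_int \<uplus> FO_unit) n"
proof
  fix R assume "R \<in> FO_real_int n"
  then obtain \<phi> where \<phi>: "scoped real_int_vars n \<phi>" "R = {xs \<in> tuples UNIV n. sat UNIV real_int_holds xs \<phi>}"
    by (auto simp: FO_real_int_def definable_def)
  obtain L where L: "finite L" "L \<subseteq> rects n"
    "\<And>xs. xs \<in> tuples UNIV n \<Longrightarrow> sat UNIV real_int_holds xs \<phi> \<longleftrightarrow> (\<exists>r\<in>L. in_rect xs r)"
    using rect_union_sat[OF \<phi>(1)] by (rule rect_unionE) blast
  \<comment> \<open>An empty rectangle, added because \<open>L\<close> may be empty while the union
    must have \<open>p \<ge> 1\<close> members. Both formulas are closed, so they are in scope for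
    every \<open>n\<close>, including 0.\<close>
  define r0 :: "int_atom form \<times> unit_atom form" where
    "r0 = (Exists (Neg (Atom (Z_Eq (Var 0) (Var 0)))), Exists (Atom (D_Eq 0 0)))"
  have r0: "r0 \<in> rects n" "\<not> in_rect xs r0" for xs by (auto simp: r0_def rects_def in_rect_def)
  obtain rs where rs: "set rs = insert r0 L" using L(1) finite_list by (metis finite_insert)
  then have pos: "length rs \<ge> 1" by (cases rs) auto
  \<comment> \<open>The union is indexed from 1 and the list from 0, hence the shift
    \<open>i - 1\<close>.\<close>
  define Z where "Z = (\<lambda>i. {xs \<in> tuples \<int> n. sat \<int> int_holds xs (fst (rs ! (i - 1)))})"
  define D where "D = (\<lambda>i. {xs \<in> tuples unit_ico n. sat unit_ico unit_holds xs (snd (rs ! (i - 1)))})"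
  have ZD: "Z i \<in> FO_int n \<and> Z i \<subseteq> tuples \<int> n \<and> D i \<in> FO_unit n \<and> D i \<subseteq> tuples unit_ico n"
    if "i \<in> {1..length rs}" for i
  proof -
    have "i - 1 < length rs" using that by auto
    then have "rs ! (i - 1) \<in> rects n" using rs r0(1) L(2) nth_mem[of "i - 1" rs] by auto
    then show ?thesis unfolding Z_def D_def FO_int_def FO_unit_def definable_def rects_def by blast
  qed
  have mem: "xs \<in> sumset (Z i) (D i) \<longleftrightarrow> xs \<in> tuples UNIV n \<and> in_rect xs (rs ! (i - 1))" for xs i
  proof -
    have "xs \<in> sumset (Z i) (D i) \<longleftrightarrow> map ipart xs \<in> Z i \<and> map frac xs \<in> D i"
      by (rule mem_sumset_iff) (auto simp: Z_def D_def)
    also have "\<dots> \<longleftrightarrow> xs \<in> tuples UNIV n \<and> in_rect xs (rs ! (i - 1))"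
      using map_ipart_tuples[of xs n] map_frac_tuples[of xs n]
      by (auto simp: Z_def D_def in_rect_def tuples_def)
    finally show ?thesis .
  qed
  have "(\<exists>i\<in>{1..length rs}. in_rect xs (rs ! (i - 1))) \<longleftrightarrow> (\<exists>r\<in>set rs. in_rect xs r)" for xs
  proof
    assume "\<exists>r\<in>set rs. in_rect xs r"
    then obtain j where "j < length rs" "in_rect xs (rs ! j)" by (auto simp: in_set_conv_nth)
    then show "\<exists>i\<in>{1..length rs}. in_rect xs (rs ! (i - 1))" by (intro bexI[of _ "Suc j"]) auto
  qed (auto intro!: bexI[OF _ nth_mem])
  then have "R = (\<Union>i\<in>{1..length rs}. sumset (Z i) (D i))"
    using L(3) r0(2) by (simp add: \<phi>(2) set_eq_iff mem rs) blast
  with pos ZD show "R \<in> (FO_int \<uplus> FO_unit) n" unfolding class_uplus_def by blast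
qed

lemma FO_real_int_superset: "(FO_int \<uplus> FO_unit) n \<subseteq> FO_real_int n"
proof
  fix R assume "R \<in> (FO_int \<uplus> FO_unit) n"
  then obtain p Z D where R: "R = (\<Union>i\<in>{1..p::nat}. sumset (Z i) (D i))" "p \<ge> 1"
    and ZD: "\<And>i. i \<in> {1..p} \<Longrightarrow> Z i \<in> FO_int n \<and> Z i \<subseteq> tuples \<int> n \<and> D i \<in> FO_unit n \<and> D i \<subseteq> tuples unit_ico n"
    unfolding class_uplus_def by blast
  have "R \<subseteq> tuples UNIV n" using ZD unfolding R sumset_def tuples_def by fastforce
  moreover have "real_expressible n (\<lambda>xs. \<exists>i\<in>{1..p}. xs \<in> sumset (Z i) (D i))"
    using R(2) ZD by (intro expressible.bex_finite real_expressible_sumset) auto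
  ultimately show "R \<in> FO_real_int n" unfolding FO_real_int_def definable_iff R by simp
qed

theorem theorem7:
  shows "FO_real_int = FO_int \<uplus> FO_unit"
  using FO_real_int_subset FO_real_int_superset by (intro ext subset_antisym)

end
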